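(* Let $n\ge 1$, let $\alpha\in[0,1)$, let $g:\mathbb{R}\to\mathbb{R}$ be a Lipschitz continuous, $1$-periodic function with $g(v)\le 0$ for all $v$, and let $p\in\mathbb{R}^n$. For $\varepsilon>0$ let $v^\varepsilon$ be the solution to $$\begin{cases}v^\varepsilon_t-\Delta v^\varepsilon+\varepsilon^{1-\alpha}g(v^\varepsilon)=0 & x\in\mathbb{R}^n,\ t>0,\\ v^\varepsilon(x,0)=p\cdot x, & x\in\mathbb{R}^n,\end{cases}$$ and let $c^\varepsilon(p)$ be the unique constant for which $|v^\varepsilon(x,t)-p\cdot x-c^\varepsilon(p)t|$ is bounded by a constant $K$ for all $x\in\mathbb{R}^n$, $t\ge 0$. Then $$\lim_{\varepsilon\to 0}c^\varepsilon(p)\,\varepsilon^{\alpha-1}=\begin{cases}-\displaystyle\int_0^1 g(s)\,ds & \text{if } p\neq 0,\\[2mm] -\left(\displaystyle\int_0^1\frac{1}{g(s)}\,ds\right)^{-1} & \text{if } p=0 \text{ and } g<0,\\[2mm] 0 & \text{if } p=0 \text{ and } \max g=0.\end{cases}$$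
   Context: For each $p\in\mathbb{R}^n$ the Cauchy problem for $v^\varepsilon$ has a unique solution, of class $C^{2+\gamma,1+\gamma/2}$ for all $\gamma\in(0,1)$, and a comparison principle between sub- and supersolutions holds. The constant $c^\varepsilon(p)$ (average speed of propagation) is characterized as follows: there is a unique constant $c^\varepsilon(p)$ such that $|v^\varepsilon(x,t)-p\cdot x-c^\varepsilon(p)t|\le K$ for all $x\in\mathbb{R}^n$ and $t\ge 0$, where $K$ depends on the Lipschitz norm of $g$. It satisfies $c^\varepsilon(p)\le\varepsilon^{1-\alpha}\|g\|_\infty$. *)

theory Defs
  imports "HOL-Analysis.Analysis"
begin

definition partial_deriv :: "'n::finite \<Rightarrow> (real ^ 'n \<Rightarrow> real) \<Rightarrow> real ^ 'n \<Rightarrow> real" where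
  "partial_deriv i u x = deriv (\<lambda>h. u (x + h *\<^sub>R axis i 1)) 0"

definition has_partial_deriv :: "'n::finite \<Rightarrow> (real ^ 'n \<Rightarrow> real) \<Rightarrow> real ^ 'n \<Rightarrow> bool" where
  "has_partial_deriv i u x \<longleftrightarrow> (\<lambda>h. u (x + h *\<^sub>R axis i 1)) differentiable (at 0)"

definition laplacian :: "(real ^ 'n::finite \<Rightarrow> real) \<Rightarrow> real ^ 'n \<Rightarrow> real" where
  "laplacian u x = (\<Sum>i\<in>UNIV. partial_deriv i (partial_deriv i u) x)"

text \<open>Functions \<open>v x t\<close> of class \<open>C\<^sup>2\<close> in space and \<open>C\<^sup>1\<close> in time on \<open>t > 0\<close>: the derivatives
  \<open>v\<^sub>t\<close>, \<open>D v\<close> and \<open>D\<^sup>2 v\<close> exist and are jointly continuous in \<open>(x, t)\<close>.  Existence is required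
  separately because \<open>deriv\<close> is total.\<close>

definition C2_1 :: "(real ^ 'n::finite \<Rightarrow> real \<Rightarrow> real) \<Rightarrow> bool" where
  "C2_1 v \<longleftrightarrow>
     (\<forall>x. \<forall>t>0. v x differentiable (at t)) \<and>
     (\<forall>x. \<forall>t>0. \<forall>i. has_partial_deriv i (\<lambda>y. v y t) x) \<and>
     (\<forall>x. \<forall>t>0. \<forall>i j. has_partial_deriv j (partial_deriv i (\<lambda>y. v y t)) x) \<and>
     continuous_on (UNIV \<times> {0<..}) (\<lambda>(x, t). deriv (v x) t) \<and>
     (\<forall>i. continuous_on (UNIV \<times> {0<..}) (\<lambda>(x, t). partial_deriv i (\<lambda>y. v y t) x)) \<and>
     (\<forall>i j. continuous_on (UNIV \<times> {0<..})
        (\<lambda>(x, t). partial_deriv j (partial_deriv i (\<lambda>y. v y t)) x))"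

text \<open>Classical solutions of \<open>v\<^sub>t - \<Delta>v + f(v) = 0\<close> for \<open>t > 0\<close>, \<open>v(x, 0) = v\<^sub>0(x)\<close>, continuous up to
  \<open>t = 0\<close>.  Values at \<open>t < 0\<close> are irrelevant.  No growth condition at infinity is built in.
  For \<open>f\<close> Lipschitz and \<open>v\<^sub>0\<close> linear, \<open>is_average_speed\<close> below supplies one: it bounds
  \<open>v - v\<^sub>0\<close> on every strip \<open>0 \<le> t \<le> T\<close>, and in that class the solution is unique.\<close>

definition cauchy_solution ::
  "(real \<Rightarrow> real) \<Rightarrow> (real ^ 'n::finite \<Rightarrow> real) \<Rightarrow> (real ^ 'n \<Rightarrow> real \<Rightarrow> real) \<Rightarrow> bool" where
  "cauchy_solution f v0 v \<longleftrightarrow>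
     C2_1 v \<and>
     continuous_on (UNIV \<times> {0..}) (\<lambda>(x, t). v x t) \<and>
     (\<forall>x. \<forall>t>0. deriv (v x) t - laplacian (\<lambda>y. v y t) x + f (v x t) = 0) \<and>
     (\<forall>x. v x 0 = v0 x)"

definition is_average_speed ::
  "real ^ 'n::finite \<Rightarrow> (real ^ 'n \<Rightarrow> real \<Rightarrow> real) \<Rightarrow> real \<Rightarrow> bool" where
  "is_average_speed p v c \<longleftrightarrow>
     (\<exists>K. \<forall>x. \<forall>t\<ge>0. \<bar>v x t - p \<bullet> x - c * t\<bar> \<le> K)"

lemma is_average_speed_unique:
  assumes "is_average_speed p v c" "is_average_speed p v d"
  shows "c = d"
proof (rule ccontr)
  assume ne: "c \<noteq> d"
  obtain K where K: "\<And>t. t \<ge> 0 \<Longrightarrow> \<bar>v 0 t - p \<bullet> 0 - c * t\<bar> \<le> K"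
    using assms(1) unfolding is_average_speed_def by blast
  obtain L where L: "\<And>t. t \<ge> 0 \<Longrightarrow> \<bar>v 0 t - p \<bullet> 0 - d * t\<bar> \<le> L"
    using assms(2) unfolding is_average_speed_def by blast
  have "K \<ge> 0" "L \<ge> 0" using K[of 0] L[of 0] by auto
  define t where "t = (K + L + 1) / \<bar>c - d\<bar>"
  have "t \<ge> 0" using \<open>K \<ge> 0\<close> \<open>L \<ge> 0\<close> by (simp add: t_def)
  have "\<bar>(c - d) * t\<bar> = K + L + 1"
    using ne \<open>K \<ge> 0\<close> \<open>L \<ge> 0\<close> by (simp add: t_def abs_mult)
  moreover have "\<bar>(c - d) * t\<bar> \<le> K + L"
    using K[OF \<open>t \<ge> 0\<close>] L[OF \<open>t \<ge> 0\<close>] by (simp add: left_diff_distrib)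
  ultimately show False by simp
qed

end

theory Submission
  imports Defs
begin

text \<open>
  With \<open>\<delta> = \<epsilon> powr (1 - \<alpha>)\<close> everything follows by comparison with profiles \<open>W (p \<bullet> x + \<sigma> t)\<close>.
  For \<open>p \<noteq> 0\<close> take \<open>W s = s + \<delta> \<psi> s\<close> with a periodic corrector solving
  \<open>|p|\<^sup>2 \<psi>'' = g - \<integral>\<^sub>0\<^sup>1 g\<close>. At speed \<open>\<sigma> = - \<delta> \<integral>\<^sub>0\<^sup>1 g\<close> the equation holds up to
  \<open>O(\<delta>\<^sup>2)\<close>, and changing \<open>\<sigma>\<close> by \<open>\<plusminus> C \<delta>\<^sup>2\<close> absorbs the error, so \<open>c / \<delta>\<close> is within \<open>O(\<delta>)\<close>
  of the limit. For \<open>p = 0\<close> the profile solves the ODE \<open>W' = - g (W)\<close>: it is the inverse of an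
  antiderivative of \<open>- 1 / g\<close> when \<open>g < 0\<close>, and \<open>v\<close> is trapped between \<open>0\<close> and a zero of \<open>g\<close>
  otherwise, so that \<open>c / \<delta>\<close> does not even depend on \<open>\<epsilon>\<close>.
\<close>

section \<open>Parabolic comparison on the whole space\<close>

text \<open>If \<open>d > 0\<close>, then \<open>f'\<close>, which vanishes at the maximum point
  \<open>a\<close>, is positive just to the right of it, and the mean value theorem makes
  \<open>f\<close> exceed \<open>f a\<close> there.\<close>

lemma second_deriv_nonpos_at_max:
  fixes f f' :: "real \<Rightarrow> real"
  assumes f: "\<And>h. (f has_real_derivative f' h) (at h)"
    and f': "(f' has_real_derivative d) (at a)"
    and max: "\<And>h. f h \<le> f a"
  shows "d \<le> 0"
proof (rule ccontr)
  assume "\<not> d \<le> 0"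
  then obtain e where e: "e > 0" "\<And>h. h > 0 \<Longrightarrow> h < e \<Longrightarrow> f' a < f' (a + h)"
    using DERIV_pos_inc_right[OF f'] by auto
  have f'a: "f' a = 0"
    by (rule DERIV_local_max[OF f[of a], of 1]) (use max in auto)
  obtain y where y: "a < y" "y < a + e / 2" "f (a + e / 2) - f a = (a + e / 2 - a) * f' y"
    using MVT2[of a "a + e / 2" f f'] f e(1) by auto
  have "f' y > 0"
    using e(2)[of "y - a"] y f'a by simp
  then have "(a + e / 2 - a) * f' y > 0"
    using e(1) by simp
  then have "f (a + e / 2) - f a > 0"
    using y(3) by simp
  then show False using max[of "a + e / 2"] by simp
qed

text \<open>A negative derivative would give larger values just before \<open>a\<close>. Only
  earlier times are compared, because the maximum over a time strip may sit at its final
  time.\<close>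

lemma left_max_imp_deriv_nonneg:
  fixes f :: "real \<Rightarrow> real"
  assumes f: "(f has_real_derivative d) (at a)" and "b < a"
    and max: "\<And>t. b < t \<Longrightarrow> t < a \<Longrightarrow> f t \<le> f a"
  shows "d \<ge> 0"
proof (rule ccontr)
  assume "\<not> d \<ge> 0"
  then obtain e where e: "e > 0" "\<And>h. h > 0 \<Longrightarrow> h < e \<Longrightarrow> f a < f (a - h)"
    using DERIV_neg_dec_left[OF f] by auto
  define h where "h = min (e / 2) ((a - b) / 2)"
  have "h > 0" "h < e" "b < a - h" using e(1) \<open>b < a\<close> by (auto simp: h_def min_def field_simps)
  then show False using e(2)[of h] max[of "a - h"] by auto
qed

text \<open>Boundedness of \<open>z\<close> replaces a condition at infinity: the penalty
  \<open>\<eta> (|x|\<^sup>2 + (2 n + 1) t)\<close> forces a maximum to be attained, and its parabolic operator is \<open>\<eta> > 0\<close>.\<close>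

lemma parabolic_maximum_principle:
  fixes z zt :: "real ^ 'n::finite \<Rightarrow> real \<Rightarrow> real"
    and z1 z2 :: "'n \<Rightarrow> real ^ 'n \<Rightarrow> real \<Rightarrow> real"
  assumes cont: "continuous_on (UNIV \<times> {0..T}) (\<lambda>(x, t). z x t)"
    and bound: "\<And>x t. 0 \<le> t \<Longrightarrow> t \<le> T \<Longrightarrow> z x t \<le> M"
    and init: "\<And>x. z x 0 \<le> 0"
    and dt: "\<And>x t. t > 0 \<Longrightarrow> (z x has_real_derivative zt x t) (at t)"
    and d1: "\<And>i x t. t > 0 \<Longrightarrow>
      ((\<lambda>h. z (x + h *\<^sub>R axis i 1) t) has_real_derivative z1 i x t) (at 0)"
    and d2: "\<And>i x t. t > 0 \<Longrightarrow>
      ((\<lambda>h. z1 i (x + h *\<^sub>R axis i 1) t) has_real_derivative z2 i x t) (at 0)"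
    and sub: "\<And>x t. t > 0 \<Longrightarrow> z x t > 0 \<Longrightarrow> zt x t - (\<Sum>i\<in>UNIV. z2 i x t) \<le> \<Lambda> * z x t"
    and "\<Lambda> \<ge> 0" and t1: "0 \<le> t1" "t1 \<le> T"
  shows "z x1 t1 \<le> 0"
proof (rule ccontr)
  assume "\<not> z x1 t1 \<le> 0"
  then have zpos: "z x1 t1 > 0" by simp
  \<comment> \<open>The decaying weight absorbs the zeroth-order term
    \<open>\<Lambda> * z\<close>.\<close>
  define E where "E t = exp (- \<Lambda> * t)" for t
  define N where "N = real CARD('n)"
  define q where "q x t = x \<bullet> x + (2 * N + 1) * t" for x :: "real ^ 'n" and t
  have E: "E t > 0" for t by (simp add: E_def)
  have E1: "E t \<le> 1" if "t \<ge> 0" for t using that \<open>\<Lambda> \<ge> 0\<close> by (simp add: E_def)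
  have N: "N \<ge> 0" by (simp add: N_def)
  have q0: "q x t \<ge> 0" if "t \<ge> 0" for x t using that N by (simp add: q_def)
  have qx: "q x t \<ge> (norm x)\<^sup>2" if "t \<ge> 0" for x t
    using that N by (simp add: q_def power2_norm_eq_inner)
  \<comment> \<open>Small enough that the penalty at \<open>(x1, t1)\<close> takes less than half of
    \<open>E t1 * z x1 t1\<close>, so \<open>Z\<close> stays positive there; the summand 1 keeps the
    denominator positive.\<close>
  define \<eta> where "\<eta> = E t1 * z x1 t1 / (2 * (1 + q x1 t1))"
  have \<eta>: "\<eta> > 0" unfolding \<eta>_def using E zpos q0[OF t1(1), of x1] by (intro divide_pos_pos) auto
  define Z where "Z x t = E t * z x t - \<eta> * q x t" for x t
  have Z1: "Z x1 t1 > 0"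
  proof -
    have "\<eta> * (2 * (1 + q x1 t1)) = E t1 * z x1 t1"
      unfolding \<eta>_def using q0[OF t1(1), of x1] by simp
    moreover have "\<eta> * q x1 t1 \<ge> 0" using \<eta> q0[OF t1(1), of x1] by simp
    ultimately show ?thesis using \<eta> unfolding Z_def by (simp add: algebra_simps)
  qed
  have M: "M > 0" using bound[OF t1] zpos by (rule less_le_trans[rotated])
  \<comment> \<open>Beyond \<open>sqrt (M / \<eta>)\<close> the penalty exceeds the bound
    \<open>M\<close>, so positive values of \<open>Z\<close> occur only in a compact set;
    \<open>norm x1\<close> keeps \<open>x1\<close> inside it.\<close>
  define R where "R = max (norm x1) (sqrt (M / \<eta>))"
  have Zout: "Z x t < 0" if "norm x > R" "0 \<le> t" "t \<le> T" for x t
  proof -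
    have "sqrt (M / \<eta>) < norm x" using that by (simp add: R_def)
    then have "M / \<eta> < (norm x)\<^sup>2"
      by (metis norm_ge_zero abs_of_nonneg real_sqrt_abs real_sqrt_less_iff)
    also have "\<dots> \<le> q x t" using qx that by simp
    finally have "M < \<eta> * q x t" using \<eta> by (simp add: field_simps)
    moreover have "E t * z x t \<le> M"
    proof -
      have "E t * z x t \<le> E t * M" using bound that E[of t] by (intro mult_left_mono) auto
      also have "\<dots> \<le> 1 * M" using E1 that M by (intro mult_right_mono) auto
      finally show ?thesis by simp
    qed
    ultimately show ?thesis by (simp add: Z_def)
  qed
  let ?S = "cball (0 :: real ^ 'n) R \<times> {0..T}"
  have contZ: "continuous_on ?S (\<lambda>(x, t). Z x t)"
    unfolding Z_def E_def q_def split_def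
    using continuous_on_subset[OF cont, of ?S] unfolding split_def
    by (intro continuous_intros) auto
  have in1: "(x1, t1) \<in> ?S" using t1 by (auto simp: R_def)
  have "compact ?S" by (intro compact_Times) auto
  then obtain y where y: "y \<in> ?S" "\<And>w. w \<in> ?S \<Longrightarrow> (\<lambda>(x, t). Z x t) w \<le> (\<lambda>(x, t). Z x t) y"
    using continuous_attains_sup[OF _ _ contZ] in1 by blast
  obtain x0 t0 where y_eq: "y = (x0, t0)" by (cases y)
  have t0: "0 \<le> t0" "t0 \<le> T" using y(1) y_eq by auto
  have Z0: "Z x0 t0 > 0" using y(2)[OF in1] Z1 y_eq by simp
  have Zmax: "Z x t \<le> Z x0 t0" if "0 \<le> t" "t \<le> T" for x t
  proof (cases "norm x > R")
    case True
    then show ?thesis using Zout that Z0 by fastforce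
  next
    case False
    then show ?thesis using y(2)[of "(x, t)"] that y_eq by auto
  qed
  have z0: "z x0 t0 > 0"
  proof -
    have "\<eta> * q x0 t0 \<ge> 0" using \<eta> q0 t0 by simp
    then have "E t0 * z x0 t0 > 0" using Z0 by (simp add: Z_def)
    then show ?thesis using E[of t0] by (simp add: zero_less_mult_iff)
  qed
  then have t0pos: "t0 > 0" using init[of x0] t0 by (cases "t0 = 0") auto
  have "((\<lambda>t. Z x0 t) has_real_derivative
      E t0 * (zt x0 t0 - \<Lambda> * z x0 t0) - \<eta> * (2 * N + 1)) (at t0)"
    unfolding Z_def E_def q_def
    by (auto intro!: derivative_eq_intros dt t0pos simp: algebra_simps)
  then have time: "E t0 * (zt x0 t0 - \<Lambda> * z x0 t0) - \<eta> * (2 * N + 1) \<ge> 0"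
    by (rule left_max_imp_deriv_nonneg[OF _ t0pos]) (use Zmax t0 in auto)
  have space: "E t0 * z2 i x0 t0 \<le> 2 * \<eta>" for i
  proof -
    let ?a = "axis i 1 :: real ^ 'n"
    have aa: "?a \<bullet> ?a = 1" by (simp add: inner_axis_axis)
    \<comment> \<open>The derivative is assumed only at \<open>h = 0\<close> for each base point;
      moving the base point gives it at every point of the line.\<close>
    have D1: "((\<lambda>h. z (x0 + h *\<^sub>R ?a) t0) has_real_derivative z1 i (x0 + h *\<^sub>R ?a) t0) (at h)" for h
      using d1[OF t0pos, of "x0 + h *\<^sub>R ?a" i] DERIV_shift[of "\<lambda>h. z (x0 + h *\<^sub>R ?a) t0" _ 0 h]
      by (simp add: algebra_simps)
    have "E t0 * z2 i x0 t0 - \<eta> * 2 \<le> 0"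
    proof (rule second_deriv_nonpos_at_max)
      show "((\<lambda>h. Z (x0 + h *\<^sub>R ?a) t0) has_real_derivative
        E t0 * z1 i (x0 + h *\<^sub>R ?a) t0 - \<eta> * (2 * (x0 \<bullet> ?a) + 2 * h)) (at h)" for h
        unfolding Z_def q_def inner_add_left inner_add_right inner_scaleR_left inner_scaleR_right aa
        by (auto intro!: derivative_eq_intros D1 simp: algebra_simps inner_commute)
      show "((\<lambda>h. E t0 * z1 i (x0 + h *\<^sub>R ?a) t0 - \<eta> * (2 * (x0 \<bullet> ?a) + 2 * h))
        has_real_derivative E t0 * z2 i x0 t0 - \<eta> * 2) (at 0)"
        by (auto intro!: derivative_eq_intros d2 t0pos)
      show "Z (x0 + h *\<^sub>R ?a) t0 \<le> Z (x0 + 0 *\<^sub>R ?a) t0" for h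
        using Zmax t0 by simp
    qed
    then show ?thesis by simp
  qed
  \<comment> \<open>The \<open>n\<close> directions together contribute at most
    \<open>2 * N * \<eta>\<close>, whereas the time derivative demands
    \<open>(2 * N + 1) * \<eta>\<close>.\<close>
  have "E t0 * (\<Sum>i\<in>UNIV. z2 i x0 t0) \<le> (\<Sum>i\<in>(UNIV :: 'n set). 2 * \<eta>)"
    unfolding sum_distrib_left by (intro sum_mono space)
  then have "E t0 * (\<Sum>i\<in>UNIV. z2 i x0 t0) \<le> 2 * N * \<eta>" by (simp add: N_def)
  moreover have "E t0 * (zt x0 t0 - \<Lambda> * z x0 t0) \<le> E t0 * (\<Sum>i\<in>UNIV. z2 i x0 t0)"
    using sub[OF t0pos z0] E[of t0] by (intro mult_left_mono) auto
  ultimately show False using time \<eta> by (simp add: algebra_simps)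
qed

text \<open>The sign \<open>e\<close> treats supersolutions (\<open>e = 1\<close>) and subsolutions (\<open>e = -1\<close>) at once. For \<open>p = 0\<close>
  the profile need not be twice differentiable, which matters since \<open>g\<close> is merely Lipschitz.\<close>

lemma plane_wave_speed_bound:
  fixes v :: "real ^ 'n::finite \<Rightarrow> real \<Rightarrow> real" and p :: "real ^ 'n" and W W' W'' :: "real \<Rightarrow> real"
  assumes sol: "cauchy_solution f (\<lambda>x. p \<bullet> x) v"
    and speed: "is_average_speed p v c"
    and lip: "\<Lambda>-lipschitz_on UNIV f"
    and W: "\<And>s. (W has_real_derivative W' s) (at s)"
    and W': "\<And>s. p \<noteq> 0 \<Longrightarrow> (W' has_real_derivative W'' s) (at s)"
    and e: "e = 1 \<or> e = -1"
    and super: "\<And>s. 0 \<le> e * (\<sigma> * W' s - (p \<bullet> p) * W'' s + f (W s))"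
    and growth: "\<And>s. \<bar>W s - \<kappa> * s\<bar> \<le> B"
    and \<kappa>: "p = 0 \<or> \<kappa> = 1"
    and init: "\<And>x. e * (p \<bullet> x) \<le> e * W (p \<bullet> x)"
  shows "e * c \<le> e * (\<kappa> * \<sigma>)"
proof -
  have \<Lambda>: "\<Lambda> \<ge> 0" using lip by (rule lipschitz_on_nonneg)
  have C21: "C2_1 v" and cont: "continuous_on (UNIV \<times> {0..}) (\<lambda>(x, t). v x t)"
    and eq: "\<And>x t. t > 0 \<Longrightarrow> deriv (v x) t - laplacian (\<lambda>y. v y t) x + f (v x t) = 0"
    and v0: "\<And>x. v x 0 = p \<bullet> x"
    using sol unfolding cauchy_solution_def by auto
  obtain K where K: "\<And>x t. t \<ge> 0 \<Longrightarrow> \<bar>v x t - p \<bullet> x - c * t\<bar> \<le> K"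
    using speed unfolding is_average_speed_def by blast
  have vt: "(v x has_real_derivative deriv (v x) t) (at t)" if "t > 0" for x t
    using C21 that unfolding C2_1_def
    by (metis DERIV_deriv_iff_real_differentiable)
  have v1: "((\<lambda>h. v (x + h *\<^sub>R axis i 1) t) has_real_derivative partial_deriv i (\<lambda>y. v y t) x) (at 0)"
    if "t > 0" for x t i
    using C21 that unfolding C2_1_def has_partial_deriv_def partial_deriv_def
    by (metis (no_types) DERIV_deriv_iff_real_differentiable)
  have v2: "((\<lambda>h. partial_deriv i (\<lambda>y. v y t) (x + h *\<^sub>R axis i 1)) has_real_derivative
      partial_deriv i (partial_deriv i (\<lambda>y. v y t)) x) (at 0)"
    if "t > 0" for x t i
  proof -
    have "has_partial_deriv i (partial_deriv i (\<lambda>y. v y t)) x"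
      using C21 that unfolding C2_1_def by blast
    then show ?thesis
      unfolding has_partial_deriv_def partial_deriv_def[of i "partial_deriv i (\<lambda>y. v y t)"]
      by (simp add: DERIV_deriv_iff_real_differentiable)
  qed
  have pax: "p \<bullet> axis i 1 = p $ i" for i by (simp add: inner_axis)
  have pp: "p \<bullet> p = (\<Sum>i\<in>UNIV. p $ i * p $ i)" by (simp add: inner_vec_def)
  have contW: "continuous_on UNIV W"
    using W by (meson DERIV_continuous continuous_at_imp_continuous_on)
  have v_le: "e * (v x T - W (p \<bullet> x + \<sigma> * T)) \<le> 0" if "T \<ge> 0" for x T
  proof (rule parabolic_maximum_principle
      [where T = T and \<Lambda> = \<Lambda> and M = "K + B + (\<bar>c\<bar> + \<bar>\<kappa>\<bar> * \<bar>\<sigma>\<bar>) * T"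
        and z = "\<lambda>x t. e * (v x t - W (p \<bullet> x + \<sigma> * t))"
        and zt = "\<lambda>x t. e * (deriv (v x) t - \<sigma> * W' (p \<bullet> x + \<sigma> * t))"
        and ?z1.0 = "\<lambda>i x t. e * (partial_deriv i (\<lambda>y. v y t) x - p $ i * W' (p \<bullet> x + \<sigma> * t))"
        and ?z2.0 = "\<lambda>i x t. e * (partial_deriv i (partial_deriv i (\<lambda>y. v y t)) x
           - p $ i * p $ i * W'' (p \<bullet> x + \<sigma> * t))"])
    have "continuous_on (UNIV \<times> {0..T}) (\<lambda>(x, t). v x t)"
      by (rule continuous_on_subset[OF cont]) auto
    then show "continuous_on (UNIV \<times> {0..T}) (\<lambda>(x, t). e * (v x t - W (p \<bullet> x + \<sigma> * t)))"
      unfolding split_def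
      by (intro continuous_intros continuous_on_compose2[OF contW]) auto
    fix y t assume t: "0 \<le> t" "t \<le> T"
    \<comment> \<open>The linear growth in space is the same for \<open>v\<close> and for the wave:
      it is absent if \<open>p = 0\<close> and has slope one if \<open>\<kappa> = 1\<close>. Hence
      their difference is bounded on the strip.\<close>
    have "\<kappa> * (p \<bullet> y + \<sigma> * t) = p \<bullet> y + \<kappa> * \<sigma> * t" using \<kappa> by (auto simp: algebra_simps)
    then have "\<bar>v y t - W (p \<bullet> y + \<sigma> * t)\<bar> \<le> K + B + \<bar>c * t\<bar> + \<bar>\<kappa> * \<sigma> * t\<bar>"
      using K[OF t(1), of y] growth[of "p \<bullet> y + \<sigma> * t"] by linarith
    also have "\<dots> = K + B + (\<bar>c\<bar> + \<bar>\<kappa>\<bar> * \<bar>\<sigma>\<bar>) * t" using t by (simp add: abs_mult algebra_simps)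
    also have "\<dots> \<le> K + B + (\<bar>c\<bar> + \<bar>\<kappa>\<bar> * \<bar>\<sigma>\<bar>) * T" using t by (intro add_left_mono mult_left_mono) auto
    finally show "e * (v y t - W (p \<bullet> y + \<sigma> * t)) \<le> K + B + (\<bar>c\<bar> + \<bar>\<kappa>\<bar> * \<bar>\<sigma>\<bar>) * T"
      using e by auto
  next
    show "e * (v y 0 - W (p \<bullet> y + \<sigma> * 0)) \<le> 0" for y
      using init[of y] v0 by (simp add: algebra_simps)
  next
    fix y and t :: real assume t: "t > 0"
    show "((\<lambda>t. e * (v y t - W (p \<bullet> y + \<sigma> * t))) has_real_derivative
        e * (deriv (v y) t - \<sigma> * W' (p \<bullet> y + \<sigma> * t))) (at t)"
      by (auto intro!: derivative_eq_intros vt t DERIV_chain2[OF W])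
    fix i
    show "((\<lambda>h. e * (v (y + h *\<^sub>R axis i 1) t - W (p \<bullet> (y + h *\<^sub>R axis i 1) + \<sigma> * t)))
        has_real_derivative
        e * (partial_deriv i (\<lambda>y. v y t) y - p $ i * W' (p \<bullet> y + \<sigma> * t))) (at 0)"
      unfolding inner_add_right inner_scaleR_right pax
      by (auto intro!: derivative_eq_intros v1 t DERIV_chain2[OF W])
    show "((\<lambda>h. e * (partial_deriv i (\<lambda>y. v y t) (y + h *\<^sub>R axis i 1)
          - p $ i * W' (p \<bullet> (y + h *\<^sub>R axis i 1) + \<sigma> * t))) has_real_derivative
        e * (partial_deriv i (partial_deriv i (\<lambda>y. v y t)) y
          - p $ i * p $ i * W'' (p \<bullet> y + \<sigma> * t))) (at 0)"
    \<comment> \<open>For \<open>p = 0\<close> the factor \<open>p $ i\<close> removes the wave from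
      the spatial derivatives, so \<open>W'\<close> is never differentiated.\<close>
    proof (cases "p = 0")
      case True
      then show ?thesis by (auto intro!: derivative_eq_intros v2 t)
    next
      case False
      then show ?thesis unfolding inner_add_right inner_scaleR_right pax
        by (auto intro!: derivative_eq_intros v2 t DERIV_chain2[OF W'])
    qed
  next
    fix y and t :: real assume t: "t > 0" and pos: "e * (v y t - W (p \<bullet> y + \<sigma> * t)) > 0"
    define s where "s = p \<bullet> y + \<sigma> * t"
    have "(\<Sum>i\<in>UNIV. e * (partial_deriv i (partial_deriv i (\<lambda>y. v y t)) y - p $ i * p $ i * W'' s))
        = e * (laplacian (\<lambda>y. v y t) y - (p \<bullet> p) * W'' s)"
      by (simp add: pp laplacian_def sum_subtractf flip: sum_distrib_left sum_distrib_right)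
    moreover have "e * (deriv (v y) t - laplacian (\<lambda>y. v y t) y) = - e * f (v y t)"
    proof -
      have "deriv (v y) t - laplacian (\<lambda>y. v y t) y = - f (v y t)" using eq[OF t, of y] by simp
      then show ?thesis by simp
    qed
    \<comment> \<open>Where the signed difference is positive it equals its absolute value, so the
      Lipschitz bound becomes a term linear in \<open>z\<close>.\<close>
    moreover have "e * (f (W s) - f (v y t)) \<le> \<Lambda> * (e * (v y t - W s))"
    proof -
      have "e * (f (W s) - f (v y t)) \<le> \<bar>f (W s) - f (v y t)\<bar>" using e by auto
      also have "\<dots> \<le> \<Lambda> * \<bar>W s - v y t\<bar>"
        using lipschitz_onD[OF lip, of "W s" "v y t"] by (simp add: dist_real_def)
      also have "\<bar>W s - v y t\<bar> = e * (v y t - W s)"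
        using pos e unfolding s_def by auto
      finally show ?thesis .
    qed
    ultimately show "e * (deriv (v y) t - \<sigma> * W' (p \<bullet> y + \<sigma> * t))
        - (\<Sum>i\<in>UNIV. e * (partial_deriv i (partial_deriv i (\<lambda>y. v y t)) y
          - p $ i * p $ i * W'' (p \<bullet> y + \<sigma> * t)))
        \<le> \<Lambda> * (e * (v y t - W (p \<bullet> y + \<sigma> * t)))"
      using super[of s] unfolding s_def[symmetric] by (simp add: algebra_simps)
  qed (use that \<Lambda> in auto)
  show ?thesis
  proof (rule ccontr)
    assume "\<not> ?thesis"
    then have d: "e * c - e * (\<kappa> * \<sigma>) > 0" by simp
    have K0: "K \<ge> 0" and B0: "B \<ge> 0" using K[of 0 0] growth[of 0] by auto
    \<comment> \<open>At \<open>x = 0\<close>, \<open>v\<close> and the wave stay within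
      \<open>K\<close> of \<open>c * t\<close> and within \<open>B\<close> of
      \<open>\<kappa> * \<sigma> * t\<close>, so their ordering limits the gap between these lines
      to \<open>K + B\<close>. At this time the gap would be \<open>K + B + 1\<close>.\<close>
    define t where "t = (K + B + 1) / (e * c - e * (\<kappa> * \<sigma>))"
    have t: "t \<ge> 0" using d K0 B0 by (simp add: t_def)
    have "(e * c - e * (\<kappa> * \<sigma>)) * t = K + B + 1"
      unfolding t_def using d by (metis less_numeral_extra(3) nonzero_mult_div_cancel_left times_divide_eq_right)
    moreover have "(e * c - e * (\<kappa> * \<sigma>)) * t \<le> K + B"
      using K[OF t, of 0] growth[of "\<sigma> * t"] v_le[OF t, of 0] e by (auto simp: algebra_simps)
    ultimately show False by simp
  qed
qed


section \<open>Periodic functions and their antiderivatives\<close>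

lemma bounded_periodic:
  fixes f :: "real \<Rightarrow> real"
  assumes cont: "continuous_on UNIV f" and per: "\<And>s. f (s + 1) = f s"
  obtains B where "\<And>s. \<bar>f s\<bar> \<le> B"
proof -
  interpret periodic_fun_simple' f by unfold_locales (rule per)
  have "compact (f ` {0..1})"
    by (intro compact_continuous_image continuous_on_subset[OF cont]) auto
  then have "bounded (f ` {0..1})" by (rule compact_imp_bounded)
  then obtain B where B: "\<And>s. s \<in> {0..1} \<Longrightarrow> \<bar>f s\<bar> \<le> B"
    unfolding bounded_iff real_norm_def by blast
  have "\<bar>f s\<bar> \<le> B" for s
  proof -
    have "f (frac s + of_int \<lfloor>s\<rfloor>) = f (frac s)" by (rule plus_of_int)
    moreover have "frac s + of_int \<lfloor>s\<rfloor> = s" by (simp add: frac_def)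
    ultimately show ?thesis using B[of "frac s"] frac_lt_1[of s] by (simp add: less_imp_le)
  qed
  then show ?thesis by (rule that)
qed

text \<open>The increment \<open>Q (s + 1) - Q s\<close> has derivative zero, and its constant value
  is the integral over one period. Removing the corresponding linear part leaves a continuous
  periodic function, which is bounded.\<close>

lemma antiderivative_of_periodic:
  fixes q :: "real \<Rightarrow> real"
  assumes cont: "continuous_on UNIV q" and per: "\<And>s. q (s + 1) = q s"
  obtains Q B where "\<And>s. (Q has_real_derivative q s) (at s)"
    and "\<And>s. Q (s + 1) = Q s + integral {0..1} q"
    and "\<And>s. \<bar>Q s - integral {0..1} q * s\<bar> \<le> B"
proof -
  define m where "m = integral {0..1} q"
  \<comment> \<open>Infinite endpoints give one antiderivative on the whole line, negative arguments
    included.\<close>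
  have "\<exists>Q. \<forall>x :: real. - \<infinity> < ereal x \<longrightarrow> ereal x < \<infinity> \<longrightarrow> (Q has_vector_derivative q x) (at x)"
    using cont by (intro einterval_antiderivative) (auto simp: continuous_on_eq_continuous_at)
  then obtain Q where Q: "\<And>s. (Q has_real_derivative q s) (at s)"
    by (auto simp: has_real_derivative_iff_has_vector_derivative)
  have "((\<lambda>s. Q (s + 1) - Q s) has_real_derivative 0) (at s)" for s
    by (auto intro!: derivative_eq_intros DERIV_chain2[OF Q] Q simp: per)
  then have "Q (s + 1) - Q s = Q (0 + 1) - Q 0" for s
    by (intro DERIV_isconst_all[of "\<lambda>s. Q (s + 1) - Q s"]) auto
  moreover have "(q has_integral (Q 1 - Q 0)) {0..1}"
    by (rule fundamental_theorem_of_calculus)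
      (auto intro: has_field_derivative_at_within Q
        simp flip: has_real_derivative_iff_has_vector_derivative)
  then have "m = Q 1 - Q 0" unfolding m_def by (rule integral_unique)
  ultimately have step: "Q (s + 1) = Q s + m" for s by (smt (verit))
  have "continuous_on UNIV Q"
    using Q by (meson DERIV_continuous continuous_at_imp_continuous_on)
  then have "continuous_on UNIV (\<lambda>s. Q s - m * s)" by (intro continuous_intros)
  then obtain B where "\<And>s. \<bar>Q s - m * s\<bar> \<le> B"
    by (rule bounded_periodic) (auto simp: step algebra_simps)
  with Q step show ?thesis using that unfolding m_def by blast
qed

section \<open>Nonzero slope: the periodic corrector\<close>

text \<open>\<open>C\<close> and \<open>d\<close> are fixed before \<open>\<delta>\<close>,
  \<open>c\<close> and \<open>v\<close>, so division by \<open>\<delta>\<close> gives a uniform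
  error of order \<open>\<delta>\<close> in the limit.\<close>

lemma speed_of_tilted_front:
  fixes p :: "real ^ 'n::finite" and g :: "real \<Rightarrow> real"
  assumes lip: "L-lipschitz_on UNIV g" and per: "\<And>s. g (s + 1) = g s" and "p \<noteq> 0"
  obtains C d where "d > 0"
    and "\<And>\<delta> c v. 0 < \<delta> \<Longrightarrow> \<delta> \<le> d \<Longrightarrow> cauchy_solution (\<lambda>s. \<delta> * g s) (\<lambda>x. p \<bullet> x) v \<Longrightarrow>
      is_average_speed p v c \<Longrightarrow> \<bar>c + \<delta> * integral {0..1} g\<bar> \<le> C * \<delta>\<^sup>2"
proof -
  define m where "m = - integral {0..1} g"
  have contg: "continuous_on UNIV g" by (rule lipschitz_on_continuous_on[OF lip])
  have L: "L \<ge> 0" using lip by (rule lipschitz_on_nonneg)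
  have pp: "p \<bullet> p > 0" using \<open>p \<noteq> 0\<close> by simp
  obtain H where H: "\<And>s. (H has_real_derivative g s) (at s)"
    and Hper: "\<And>s. H (s + 1) = H s + integral {0..1} g"
    using antiderivative_of_periodic[OF contg per] by metis
  have contH: "continuous_on UNIV H"
    using H by (meson DERIV_continuous continuous_at_imp_continuous_on)
  \<comment> \<open>The term \<open>m * s\<close> makes the first antiderivative periodic, and
    subtracting its mean makes the second one bounded. Up to the factor
    \<open>p \<bullet> p\<close>, \<open>q\<close> is the derivative of the corrector.\<close>
  define q where "q s = H s + m * s - integral {0..1} (\<lambda>s. H s + m * s)" for s
  have contq: "continuous_on UNIV q" unfolding q_def by (intro continuous_intros contH)
  have perq: "q (s + 1) = q s" for s unfolding q_def Hper m_def by (simp add: algebra_simps)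
  have "(\<lambda>s. H s + m * s) integrable_on {0..1}"
    by (intro integrable_continuous_interval continuous_intros continuous_on_subset[OF contH]) auto
  then have q_int: "integral {0..1} q = 0"
    unfolding q_def [abs_def] by (subst Henstock_Kurzweil_Integration.integral_diff) auto
  have q': "(q has_real_derivative g s + m) (at s)" for s
    unfolding q_def by (auto intro!: derivative_eq_intros H)
  obtain Q B where Q: "\<And>s. (Q has_real_derivative q s) (at s)" and QB: "\<And>s. \<bar>Q s\<bar> \<le> B"
    using antiderivative_of_periodic[OF contq perq] unfolding q_int by (metis diff_zero mult_zero_left)
  obtain B1 where B1: "\<And>s. \<bar>q s\<bar> \<le> B1"
    using bounded_periodic[OF contq perq] by blast
  have B: "B \<ge> 0" "B1 \<ge> 0" using QB[of 0] B1[of 0] by auto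
  \<comment> \<open>The added constant \<open>e * B\<close> gives \<open>e * \<psi> e s\<close> a
    nonnegative sign, which puts the wave on the correct side of the initial datum without changing
    its derivatives.\<close>
  define \<psi> where "\<psi> e s = (Q s + e * B) / (p \<bullet> p)" for e s
  define D where "D = 2 * B / (p \<bullet> p)"
  define D1 where "D1 = B1 / (p \<bullet> p)"
  have D: "D \<ge> 0" "D1 \<ge> 0" using B pp by (auto simp: D_def D1_def)
  have \<psi>'B: "\<bar>q s / (p \<bullet> p)\<bar> \<le> D1" for s
    using B1[of s] pp by (simp add: D1_def divide_right_mono)
  \<comment> \<open>\<open>D\<close> and \<open>D1\<close> bound the corrector and its derivative.
    The factor 2 compensates for the lower bound 1/2 on the slope of the profile.\<close>
  define C where "C = 2 * (\<bar>m\<bar> * D1 + L * D)"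
  have C: "C \<ge> 0" using D L by (simp add: C_def)
  \<comment> \<open>The smallness of \<open>\<delta>\<close> gives
    \<open>\<delta> * D1 \<le> 1 / 2\<close>, hence a profile of slope at least 1/2; the two signs
    \<open>e\<close> give the upper and the lower bound on \<open>c\<close>.\<close>
  have main: "e * c \<le> e * (\<delta> * m) + C * \<delta>\<^sup>2"
    if \<delta>: "0 < \<delta>" "\<delta> \<le> 1 / (2 * (D1 + 1))" and sol: "cauchy_solution (\<lambda>s. \<delta> * g s) (\<lambda>x. p \<bullet> x) v"
      and speed: "is_average_speed p v c" and e: "e = 1 \<or> e = -1" for e \<delta> c :: real and v
  proof -
    have ee: "e * e = 1" using e by auto
    have \<psi>0: "0 \<le> e * \<psi> e s" for s
      using e QB[of s] pp by (auto simp: \<psi>_def field_simps)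
    have \<psi>B: "\<bar>\<psi> e s\<bar> \<le> D" for s
    proof -
      have "\<bar>Q s + e * B\<bar> \<le> 2 * B" using e QB[of s] B by auto
      then show ?thesis using pp by (simp add: \<psi>_def D_def divide_right_mono)
    qed
    have \<psi>': "(\<psi> e has_real_derivative q s / (p \<bullet> p)) (at s)" for s
      unfolding \<psi>_def using pp by (auto intro!: derivative_eq_intros Q)
    \<comment> \<open>The correction to the leading speed is directed by \<open>e\<close>: faster
      for a supersolution, slower for a subsolution.\<close>
    define \<sigma> where "\<sigma> = \<delta> * m + e * (C * \<delta>\<^sup>2)"
    have "e * c \<le> e * (1 * \<sigma>)"
    proof (rule plane_wave_speed_bound[OF sol speed, where W = "\<lambda>s. s + \<delta> * \<psi> e s"
          and W' = "\<lambda>s. 1 + \<delta> * (q s / (p \<bullet> p))"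
          and W'' = "\<lambda>s. \<delta> * ((g s + m) / (p \<bullet> p))" and B = "\<delta> * D"])
      show "(\<delta> * L)-lipschitz_on UNIV (\<lambda>s. \<delta> * g s)"
        using lipschitz_on_cmult_real[OF lip, of \<delta>] \<delta> by simp
      show "((\<lambda>s. s + \<delta> * \<psi> e s) has_real_derivative 1 + \<delta> * (q s / (p \<bullet> p))) (at s)" for s
        by (auto intro!: derivative_eq_intros \<psi>')
      show "((\<lambda>s. 1 + \<delta> * (q s / (p \<bullet> p))) has_real_derivative \<delta> * ((g s + m) / (p \<bullet> p))) (at s)" for s
        using pp by (auto intro!: derivative_eq_intros q')
      show "\<bar>s + \<delta> * \<psi> e s - 1 * s\<bar> \<le> \<delta> * D" for s
        using \<psi>B[of s] \<delta> by (simp add: abs_mult)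
      show "e * (p \<bullet> x) \<le> e * (p \<bullet> x + \<delta> * \<psi> e (p \<bullet> x))" for x
        using mult_nonneg_nonneg[OF less_imp_le[OF \<delta>(1)] \<psi>0[of "p \<bullet> x"]]
        by (simp add: algebra_simps)
      fix s
      define r where "r = q s / (p \<bullet> p)"
      have r: "\<bar>r\<bar> \<le> D1" using \<psi>'B by (simp add: r_def)
      have "\<bar>\<delta> * r\<bar> \<le> \<delta> * D1" using r \<delta> by (simp add: abs_mult)
      also have "\<dots> \<le> 1 / 2" using \<delta> D by (simp add: field_simps)
      finally have half: "1 + \<delta> * r \<ge> 1 / 2" by (simp add: abs_le_iff)
      have "\<bar>g (s + \<delta> * \<psi> e s) - g s\<bar> \<le> L * \<bar>\<delta> * \<psi> e s\<bar>"
        using lipschitz_onD[OF lip, of "s + \<delta> * \<psi> e s" s] by (simp add: dist_real_def)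
      also have "\<dots> \<le> L * (\<delta> * D)"
        using L \<psi>B[of s] \<delta> by (intro mult_left_mono) (simp_all add: abs_mult)
      finally have gdiff: "\<bar>g (s + \<delta> * \<psi> e s) - g s\<bar> \<le> \<delta> * (L * D)" by (simp add: mult_ac)
      \<comment> \<open>This is the residual of the profile at speed \<open>\<delta> * m\<close>,
        divided by \<open>\<delta>\<close>: the corrector has cancelled \<open>g s + m\<close>. What
        is left comes from the slope of the corrector and from the shifted argument of
        \<open>g\<close>.\<close>
      have "\<bar>\<delta> * m * r + (g (s + \<delta> * \<psi> e s) - g s)\<bar> \<le> \<delta> * (\<bar>m\<bar> * D1) + \<delta> * (L * D)"
      proof -
        have "\<bar>\<delta> * m * r\<bar> \<le> \<delta> * (\<bar>m\<bar> * D1)"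
          using r \<delta> by (simp add: abs_mult mult.assoc mult_left_mono)
        then show ?thesis using gdiff by linarith
      qed
      also have "\<dots> = \<delta> * C * (1 / 2)" by (simp add: C_def algebra_simps)
      also have "\<dots> \<le> \<delta> * C * (1 + \<delta> * r)" using half C \<delta> by (intro mult_left_mono) auto
      finally have "0 \<le> e * (\<delta> * m * r + (g (s + \<delta> * \<psi> e s) - g s)) + \<delta> * C * (1 + \<delta> * r)"
        using e by auto
      then have "0 \<le> \<delta> * (e * (\<delta> * m * r + (g (s + \<delta> * \<psi> e s) - g s)) + \<delta> * C * (1 + \<delta> * r))"
        using \<delta> by simp
      also have "\<dots> = e * (\<delta> * m * (1 + \<delta> * r) - \<delta> * (g s + m) + \<delta> * g (s + \<delta> * \<psi> e s))
          + C * \<delta>\<^sup>2 * (1 + \<delta> * r)"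
        by (simp add: algebra_simps power2_eq_square)
      also have "C * \<delta>\<^sup>2 * (1 + \<delta> * r) = e * (e * (C * \<delta>\<^sup>2) * (1 + \<delta> * r))"
        using ee by (simp flip: mult.assoc)
      also have "\<delta> * (g s + m) = (p \<bullet> p) * (\<delta> * ((g s + m) / (p \<bullet> p)))" using pp by simp
      finally show "0 \<le> e * (\<sigma> * (1 + \<delta> * (q s / (p \<bullet> p))) -
          (p \<bullet> p) * (\<delta> * ((g s + m) / (p \<bullet> p))) + \<delta> * g (s + \<delta> * \<psi> e s))"
        unfolding \<sigma>_def r_def[symmetric] by (simp only: algebra_simps)
    qed (use e in auto)
    also have "\<dots> = e * (\<delta> * m) + e * e * (C * \<delta>\<^sup>2)" by (simp add: \<sigma>_def algebra_simps)
    finally show ?thesis using ee by simp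
  qed
  show ?thesis
  proof (rule that)
    show "1 / (2 * (D1 + 1)) > 0" using D by simp
    show "\<bar>c + \<delta> * integral {0..1} g\<bar> \<le> C * \<delta>\<^sup>2"
      if "0 < \<delta>" "\<delta> \<le> 1 / (2 * (D1 + 1))" "cauchy_solution (\<lambda>s. \<delta> * g s) (\<lambda>x. p \<bullet> x) v"
        "is_average_speed p v c" for \<delta> c v
      using main[OF that, of 1] main[OF that, of "-1"] by (simp add: m_def abs_le_iff)
  qed
qed

section \<open>Zero slope: the ordinary differential equation\<close>

text \<open>The profile solves the equation exactly, with \<open>\<delta>\<close> acting only as a
  rescaling of time, so it is both a supersolution and a subsolution and gives the speed with no
  error term. Its mean growth rate is \<open>inverse P\<close>, where \<open>1 / P\<close> is the
  harmonic mean of \<open>- g\<close> over a period.\<close>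

lemma speed_of_flat_front_negative:
  fixes g :: "real \<Rightarrow> real"
  assumes lip: "L-lipschitz_on UNIV g" and per: "\<And>s. g (s + 1) = g s" and neg: "\<And>s. g s < 0"
    and "\<delta> > 0" and sol: "cauchy_solution (\<lambda>s. \<delta> * g s) (\<lambda>x. (0 :: real ^ 'n::finite) \<bullet> x) v"
    and speed: "is_average_speed 0 v c"
  shows "c = - inverse (integral {0..1} (\<lambda>s. 1 / g s)) * \<delta>"
proof -
  have contg: "continuous_on UNIV g" by (rule lipschitz_on_continuous_on[OF lip])
  have g0: "g s \<noteq> 0" for s using neg[of s] by simp
  define k where "k s = - (1 / g s)" for s
  have contk: "continuous_on UNIV k" unfolding k_def using g0 by (intro continuous_intros contg) auto
  have kpos: "k s > 0" for s using neg[of s] by (simp add: k_def)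
  define P where "P = integral {0..1} k"
  obtain G B where G: "\<And>s. (G has_real_derivative k s) (at s)"
    and GB: "\<And>s. \<bar>G s - P * s\<bar> \<le> B" and Gper: "\<And>s. G (s + 1) = G s + P"
    using antiderivative_of_periodic[OF contk] per unfolding P_def k_def by metis
  have mono: "strict_mono G"
  proof (rule strict_monoI)
    fix x y :: real assume "x < y"
    then show "G x < G y"
      by (rule DERIV_pos_imp_increasing) (use G kpos in blast)
  qed
  have contG: "isCont G s" for s using G by (rule DERIV_isCont)
  have P: "P > 0" using Gper[of 0] strict_monoD[OF mono, of 0 1] by simp
  have "\<exists>s. G s = t" for t
  proof -
    \<comment> \<open>\<open>G\<close> stays within \<open>B\<close> of the line of slope
      \<open>P\<close>, so its values at \<open>- b\<close> and \<open>b\<close> enclose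
      \<open>t\<close>.\<close>
    define b where "b = (\<bar>t\<bar> + B) / P"
    have b: "P * b = \<bar>t\<bar> + B" using P by (simp add: b_def)
    have "B \<ge> 0" using GB[of 0] by auto
    then have "- b \<le> b" using P by (simp add: b_def)
    moreover have "G (- b) \<le> t" "t \<le> G b" using GB[of b] GB[of "- b"] b by auto
    ultimately show ?thesis using IVT[of G "- b" t b] contG by auto
  qed
  then obtain \<phi> where \<phi>: "\<And>t. G (\<phi> t) = t" by metis
  have \<phi>G: "\<phi> (G s) = s" for s
    using \<phi>[of "G s"] strict_mono_eq[OF mono] by blast
  have cont\<phi>: "isCont \<phi> t" for t
    using isCont_inverse_function[of 1 "\<phi> t" \<phi> G] \<phi>G contG \<phi> by simp
  have \<phi>': "(\<phi> has_real_derivative - g (\<phi> t)) (at t)" for t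
  proof -
    have "(\<phi> has_real_derivative inverse (k (\<phi> t))) (at t)"
      by (rule DERIV_inverse_function[where a = "t - 1" and b = "t + 1", OF G])
        (use kpos[of "\<phi> t"] \<phi> cont\<phi> in auto)
    then show ?thesis by (simp add: k_def)
  qed
  \<comment> \<open>The shift by \<open>G 0\<close> makes the profile start at 0, the initial datum
    for \<open>p = 0\<close>.\<close>
  define \<phi>0 where "\<phi>0 s = \<phi> (s + G 0)" for s
  have \<phi>0': "(\<phi>0 has_real_derivative - g (\<phi>0 s)) (at s)" for s
    unfolding \<phi>0_def using DERIV_shift[of \<phi>] \<phi>' by blast
  have growth: "\<bar>\<phi>0 s - inverse P * s\<bar> \<le> (B + \<bar>G 0\<bar>) / P" for s
  proof -
    have "\<bar>P * \<phi>0 s - s\<bar> \<le> B + \<bar>G 0\<bar>"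
      using GB[of "\<phi>0 s"] unfolding \<phi>0_def \<phi> by linarith
    then have "\<bar>P * \<phi>0 s - s\<bar> / P \<le> (B + \<bar>G 0\<bar>) / P"
      using P by (intro divide_right_mono) auto
    also have "\<bar>P * \<phi>0 s - s\<bar> / P = \<bar>(P * \<phi>0 s - s) / P\<bar>" using P by simp
    also have "(P * \<phi>0 s - s) / P = \<phi>0 s - inverse P * s" using P by (simp add: field_simps)
    finally show ?thesis .
  qed
  have "e * c \<le> e * (inverse P * \<delta>)" if e: "e = 1 \<or> e = -1" for e
  proof (rule plane_wave_speed_bound[OF sol speed, where W = \<phi>0 and W' = "\<lambda>s. - g (\<phi>0 s)"])
    show "(\<delta> * L)-lipschitz_on UNIV (\<lambda>s. \<delta> * g s)"
      using lipschitz_on_cmult_real[OF lip, of \<delta>] \<open>\<delta> > 0\<close> by simp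
  qed (use e \<phi>0' growth \<phi>G[of 0] in \<open>auto simp: \<phi>0_def\<close>)
  from this[of 1] this[of "-1"] have "c = inverse P * \<delta>" by simp
  moreover have "P = - integral {0..1} (\<lambda>s. 1 / g s)" by (simp add: P_def k_def [abs_def])
  ultimately show ?thesis by simp
qed

text \<open>Constants serve as stationary barriers: a zero of \<open>g\<close> above and 0 below.
  They enclose \<open>v\<close>, and having growth rate and speed zero they force
  \<open>c = 0\<close>.\<close>

lemma speed_of_flat_front_pinned:
  fixes g :: "real \<Rightarrow> real"
  assumes lip: "L-lipschitz_on UNIV g" and per: "\<And>s. g (s + 1) = g s" and nonpos: "\<And>s. g s \<le> 0"
    and zero: "g s0 = 0"
    and "\<delta> > 0" and sol: "cauchy_solution (\<lambda>s. \<delta> * g s) (\<lambda>x. (0 :: real ^ 'n::finite) \<bullet> x) v"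
    and speed: "is_average_speed 0 v c"
  shows "c = 0"
proof -
  interpret periodic_fun_simple' g by unfold_locales (rule per)
  have lip\<delta>: "(\<delta> * L)-lipschitz_on UNIV (\<lambda>s. \<delta> * g s)"
    using lipschitz_on_cmult_real[OF lip, of \<delta>] \<open>\<delta> > 0\<close> by simp
  \<comment> \<open>Periodicity moves the zero into the interval from 0 to 1, so that it lies at or
    above the initial datum 0.\<close>
  have "g (frac s0 + of_int \<lfloor>s0\<rfloor>) = g (frac s0)" by (rule plus_of_int)
  then have "g (frac s0) = 0" using zero by (simp add: frac_def)
  then have "1 * c \<le> 1 * (0 * 0)"
    by (intro plane_wave_speed_bound[OF sol speed lip\<delta>, where W = "\<lambda>_. frac s0"
          and W' = "\<lambda>_. 0" and B = "frac s0"]) auto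
  \<comment> \<open>The constant 0 is a subsolution because \<open>g 0 \<le> 0\<close>.\<close>
  moreover have "-1 * c \<le> -1 * (0 * 0)"
    using nonpos[of 0] \<open>\<delta> > 0\<close>
    by (intro plane_wave_speed_bound[OF sol speed lip\<delta>, where W = "\<lambda>_. 0" and W' = "\<lambda>_. 0" and B = 0])
      (auto simp: mult_nonneg_nonpos)
  ultimately show ?thesis by simp
qed

section \<open>The limit of the rescaled speeds\<close>

theorem proposition2p1:
  fixes \<alpha> :: real
    and g :: "real \<Rightarrow> real"
    and p :: "real ^ 'n"
    and v :: "real \<Rightarrow> real ^ 'n \<Rightarrow> real \<Rightarrow> real"
    and c :: "real \<Rightarrow> real"
  assumes "0 \<le> \<alpha>" and "\<alpha> < 1"
    and "\<exists>L. L-lipschitz_on UNIV g"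
    and "\<And>s. g (s + 1) = g s"
    and "\<And>s. g s \<le> 0"
    and "\<And>\<epsilon>. \<epsilon> > 0 \<Longrightarrow>
           cauchy_solution (\<lambda>s. \<epsilon> powr (1 - \<alpha>) * g s) (\<lambda>x. p \<bullet> x) (v \<epsilon>)"
    and "\<And>\<epsilon>. \<epsilon> > 0 \<Longrightarrow> is_average_speed p (v \<epsilon>) (c \<epsilon>)"
  shows "(p \<noteq> 0 \<longrightarrow>
            ((\<lambda>\<epsilon>. c \<epsilon> * \<epsilon> powr (\<alpha> - 1)) \<longlongrightarrow> - integral {0..1} g) (at_right 0)) \<and>
         (p = 0 \<and> (\<forall>s. g s < 0) \<longrightarrow>
            ((\<lambda>\<epsilon>. c \<epsilon> * \<epsilon> powr (\<alpha> - 1)) \<longlongrightarrow>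
               - inverse (integral {0..1} (\<lambda>s. 1 / g s))) (at_right 0)) \<and>
         (p = 0 \<and> (\<exists>s. g s = 0 \<and> (\<forall>r. g r \<le> g s)) \<longrightarrow>
            ((\<lambda>\<epsilon>. c \<epsilon> * \<epsilon> powr (\<alpha> - 1)) \<longlongrightarrow> 0) (at_right 0))"
proof -
  define \<delta> where "\<delta> \<epsilon> = \<epsilon> powr (1 - \<alpha>)" for \<epsilon>
  obtain L where lip: "L-lipschitz_on UNIV g" using assms(3) by blast
  have \<delta>pos: "\<delta> \<epsilon> > 0" if "\<epsilon> > 0" for \<epsilon> using that by (simp add: \<delta>_def)
  have scale: "c \<epsilon> * \<epsilon> powr (\<alpha> - 1) = c \<epsilon> / \<delta> \<epsilon>" for \<epsilon>
    by (simp add: \<delta>_def divide_inverse flip: powr_minus)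
  have sol: "cauchy_solution (\<lambda>s. \<delta> \<epsilon> * g s) (\<lambda>x. p \<bullet> x) (v \<epsilon>)" if "\<epsilon> > 0" for \<epsilon>
    using assms(6)[OF that] by (simp add: \<delta>_def)
  have pos: "\<forall>\<^sub>F \<epsilon> :: real in at_right 0. \<epsilon> > 0" by (rule eventually_at_right_less)
  have \<delta>lim: "(\<delta> \<longlongrightarrow> 0) (at_right 0)"
  proof -
    \<comment> \<open>The limit of the base is 0, so continuity of the power rests on the positive
      exponent and a nonnegative base nearby.\<close>
    have "((\<lambda>\<epsilon>. \<epsilon> powr (1 - \<alpha>)) \<longlongrightarrow> 0 powr (1 - \<alpha>)) (at_right (0 :: real))"
      using assms(2) eventually_at_right_less[of "0 :: real"]
      by (intro tendsto_powr' tendsto_ident_at tendsto_const) (auto elim: eventually_mono)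
    then show ?thesis using assms(2) by (simp add: \<delta>_def [abs_def])
  qed
  show ?thesis
  proof (intro conjI impI)
    assume "p \<noteq> 0"
    obtain C d where "d > 0" and bound: "\<And>\<delta> c v. 0 < \<delta> \<Longrightarrow> \<delta> \<le> d \<Longrightarrow>
        cauchy_solution (\<lambda>s. \<delta> * g s) (\<lambda>x. p \<bullet> x) v \<Longrightarrow> is_average_speed p v c \<Longrightarrow>
        \<bar>c + \<delta> * integral {0..1} g\<bar> \<le> C * \<delta>\<^sup>2"
      using speed_of_tilted_front[OF lip assms(4) \<open>p \<noteq> 0\<close>] by metis
    \<comment> \<open>Eventually \<open>\<delta> \<epsilon>\<close> is below the threshold
      \<open>d\<close>, and division by it turns the quadratic error into a linear one.\<close>
    have "\<forall>\<^sub>F \<epsilon> in at_right 0. norm (c \<epsilon> / \<delta> \<epsilon> - - integral {0..1} g) \<le> C * \<delta> \<epsilon>"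
      using pos order_tendstoD(2)[OF \<delta>lim \<open>d > 0\<close>]
    proof eventually_elim
      case (elim \<epsilon>)
      have "\<bar>c \<epsilon> + \<delta> \<epsilon> * integral {0..1} g\<bar> \<le> C * (\<delta> \<epsilon>)\<^sup>2"
        using bound[OF \<delta>pos _ sol assms(7)] elim by simp
      then have "\<bar>c \<epsilon> + \<delta> \<epsilon> * integral {0..1} g\<bar> / \<delta> \<epsilon> \<le> C * \<delta> \<epsilon>"
        using \<delta>pos[OF elim(1)] by (simp add: field_simps power2_eq_square)
      also have "\<bar>c \<epsilon> + \<delta> \<epsilon> * integral {0..1} g\<bar> / \<delta> \<epsilon>
          = \<bar>(c \<epsilon> + \<delta> \<epsilon> * integral {0..1} g) / \<delta> \<epsilon>\<bar>"
        using \<delta>pos[OF elim(1)] by simp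
      also have "(c \<epsilon> + \<delta> \<epsilon> * integral {0..1} g) / \<delta> \<epsilon> = c \<epsilon> / \<delta> \<epsilon> - - integral {0..1} g"
        using \<delta>pos[OF elim(1)] by (simp add: field_simps)
      finally show ?case by simp
    qed
    then have "((\<lambda>\<epsilon>. c \<epsilon> / \<delta> \<epsilon> - - integral {0..1} g) \<longlongrightarrow> 0) (at_right 0)"
      by (rule Lim_null_comparison) (use tendsto_mult_right_zero[OF \<delta>lim] in simp)
    then show "((\<lambda>\<epsilon>. c \<epsilon> * \<epsilon> powr (\<alpha> - 1)) \<longlongrightarrow> - integral {0..1} g) (at_right 0)"
      unfolding scale by (rule Lim_null[THEN iffD2])
  next
    assume "p = 0 \<and> (\<forall>s. g s < 0)"
    then have p0: "p = 0" and neg: "\<And>s. g s < 0" by auto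
    have "c \<epsilon> = - inverse (integral {0..1} (\<lambda>s. 1 / g s)) * \<delta> \<epsilon>" if "\<epsilon> > 0" for \<epsilon>
      using speed_of_flat_front_negative[OF lip assms(4) neg \<delta>pos] sol assms(7) that
      unfolding p0 by blast
    then have "c \<epsilon> / \<delta> \<epsilon> = - inverse (integral {0..1} (\<lambda>s. 1 / g s))" if "\<epsilon> > 0" for \<epsilon>
      using that \<delta>pos[OF that] by simp
    then have "\<forall>\<^sub>F \<epsilon> in at_right 0. c \<epsilon> / \<delta> \<epsilon> = - inverse (integral {0..1} (\<lambda>s. 1 / g s))"
      using pos by (auto elim: eventually_mono)
    then show "((\<lambda>\<epsilon>. c \<epsilon> * \<epsilon> powr (\<alpha> - 1)) \<longlongrightarrow>
        - inverse (integral {0..1} (\<lambda>s. 1 / g s))) (at_right 0)"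
      unfolding scale by (rule tendsto_eventually)
  next
    assume "p = 0 \<and> (\<exists>s. g s = 0 \<and> (\<forall>r. g r \<le> g s))"
    then obtain s0 where s0: "p = 0" "g s0 = 0" by blast
    have "c \<epsilon> = 0" if "\<epsilon> > 0" for \<epsilon>
      using speed_of_flat_front_pinned[OF lip assms(4,5) s0(2) \<delta>pos] sol assms(7) that unfolding s0(1) by blast
    then have "\<forall>\<^sub>F \<epsilon> in at_right 0. c \<epsilon> / \<delta> \<epsilon> = 0"
      using pos by (auto elim: eventually_mono)
    then show "((\<lambda>\<epsilon>. c \<epsilon> * \<epsilon> powr (\<alpha> - 1)) \<longlongrightarrow> 0) (at_right 0)"
      unfolding scale by (rule tendsto_eventually)
  qed
qed

end
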